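(* Let $(a_0,a_1,\dots)$ be an infinite sequence of nonnegative integers with $a_n\neq 0$ for all $n$. Then $(a_n)$ determines a unique point if and only if $\prod_{n=0}^{\infty}(1-\lambda_n)=0$.
   Context: Let $\Delta=\{(x,y)\in\mathbb{R}^2: 1\ge x\ge y>0\}$. For each integer $k\ge 0$ let $\Delta_k=\{(x,y)\in\Delta: 1-x-ky\ge 0> 1-x-(k+1)y\}$. The triangle map is $T(\alpha,\beta)=\left(\frac{\beta}{\alpha},\frac{1-\alpha-k\beta}{\alpha}\right)$ for $(\alpha,\beta)\in\Delta_k$. For nonnegative integers $a_0,\dots,a_n$, $\Delta(a_0,\dots,a_n)=\{(x,y)\in\Delta: T^k(x,y)\in\Delta_{a_k}\text{ for }0\le k\le n\}$ (a triangle). The infinite sequence $(a_n)$ is said to determine a unique point if the diameter of $\Delta(a_0,\dots,a_n)$ tends to $0$ as $n\to\infty$ (otherwise the nested triangles shrink to a nondegenerate line segment). Define $C_{-3}=(1,0,0)$, $C_{-2}=(0,1,0)$, $C_{-1}=(0,0,1)$, $C_k=C_{k-3}-C_{k-2}-a_kC_{k-1}$ ($k\ge0$), $X_k=C_k\times C_{k+1}$ ($k\ge -3$), $X_k=(x_k,y_k,z_k)$. For $V=(a,b,c)$ with $a\ne0$, $\hat V=(b/a,c/a)\in\mathbb{R}^2$; for $V=(a,b,c)$, $W=(d,e,f)$, $V\hat{+}W=\left(\frac{b+e}{a+d},\frac{c+f}{a+d}\right)$. With $d$ the Euclidean distance, for $n\ge0$ set $\lambda_n=\dfrac{d(\hat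 X_{n-1},\hat X_{n+1})}{d(\hat X_{n-1},X_n\hat{+}X_{n-2})}$. *)

theory Defs
  imports "HOL-Analysis.Analysis"
begin

definition Tri :: "(real \<times> real) set" where
  "Tri = {(x, y). 1 \<ge> x \<and> x \<ge> y \<and> y > 0}"

definition Tri_piece :: "nat \<Rightarrow> (real \<times> real) set" where
  "Tri_piece k = {(x, y) \<in> Tri. 1 - x - real k * y \<ge> 0 \<and> 0 > 1 - x - real (k + 1) * y}"

text \<open>The map is only meaningful on \<open>Tri\<close>, where the index \<open>k\<close> is unique
  (see \<open>Tri_piece_ex1\<close> and \<open>tri_map_eq\<close>); elsewhere its value is irrelevant.\<close>

definition tri_map :: "real \<times> real \<Rightarrow> real \<times> real" where
  "tri_map p = (let k = (THE k. p \<in> Tri_piece k) in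
     (snd p / fst p, (1 - fst p - real k * snd p) / fst p))"

text \<open>The requirement for every \<open>k \<le> n\<close> forces each iterate to lie in \<open>Tri\<close> before the map
  is applied to it again, so values of \<open>tri_map\<close> outside \<open>Tri\<close> play no role.\<close>

definition Tri_seq :: "(nat \<Rightarrow> nat) \<Rightarrow> nat \<Rightarrow> (real \<times> real) set" where
  "Tri_seq a n = {p \<in> Tri. \<forall>k\<le>n. (tri_map ^^ k) p \<in> Tri_piece (a k)}"

definition determines_unique_point :: "(nat \<Rightarrow> nat) \<Rightarrow> bool" where
  "determines_unique_point a \<longleftrightarrow> (\<lambda>n. diameter (Tri_seq a n)) \<longlonglongrightarrow> 0"

text \<open>\<open>C_shift a m\<close> is the vector \<open>C\<^sub>k\<close> with \<open>k = m - 3\<close>.\<close>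

fun C_shift :: "(nat \<Rightarrow> nat) \<Rightarrow> nat \<Rightarrow> real ^ 3" where
  "C_shift a 0 = vector [1, 0, 0]"
| "C_shift a (Suc 0) = vector [0, 1, 0]"
| "C_shift a (Suc (Suc 0)) = vector [0, 0, 1]"
| "C_shift a (Suc (Suc (Suc k))) =
     C_shift a k - C_shift a (Suc k) - real (a k) *\<^sub>R C_shift a (Suc (Suc k))"

text \<open>Only indices \<open>k \<ge> - 3\<close> are meaningful for \<open>Cvec\<close> and \<open>Xvec\<close>.\<close>

definition Cvec :: "(nat \<Rightarrow> nat) \<Rightarrow> int \<Rightarrow> real ^ 3" where
  "Cvec a k = C_shift a (nat (k + 3))"

definition Xvec :: "(nat \<Rightarrow> nat) \<Rightarrow> int \<Rightarrow> real ^ 3" where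
  "Xvec a k = cross3 (Cvec a k) (Cvec a (k + 1))"

definition proj_hat :: "real ^ 3 \<Rightarrow> real \<times> real" where
  "proj_hat V = (V $ 2 / V $ 1, V $ 3 / V $ 1)"

definition hat_add :: "real ^ 3 \<Rightarrow> real ^ 3 \<Rightarrow> real \<times> real" where
  "hat_add V W = ((V $ 2 + W $ 2) / (V $ 1 + W $ 1), (V $ 3 + W $ 3) / (V $ 1 + W $ 1))"

text \<open>\<open>dist\<close> on \<open>real \<times> real\<close> is the Euclidean distance.\<close>

definition lam :: "(nat \<Rightarrow> nat) \<Rightarrow> nat \<Rightarrow> real" where
  "lam a n =
     dist (proj_hat (Xvec a (int n - 1))) (proj_hat (Xvec a (int n + 1))) /
     dist (proj_hat (Xvec a (int n - 1))) (hat_add (Xvec a (int n)) (Xvec a (int n - 2)))"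

lemma Tri_piece_inj:
  assumes "p \<in> Tri_piece j" "p \<in> Tri_piece k"
  shows "j = k"
proof -
  obtain x y where p: "p = (x, y)" by (cases p)
  have y: "y > 0" using assms(1) by (simp add: p Tri_piece_def Tri_def)
  have "real j * y < real (k + 1) * y" "real k * y < real (j + 1) * y"
    using assms by (auto simp: p Tri_piece_def)
  then have "real j < real (k + 1)" "real k < real (j + 1)"
    using y mult_less_cancel_right_pos by blast+
  then show ?thesis by linarith
qed

lemma Tri_piece_ex1:
  assumes "p \<in> Tri"
  shows "\<exists>!k. p \<in> Tri_piece k"
proof -
  obtain x y where p: "p = (x, y)" by (cases p)
  have xy: "y > 0" "x \<le> 1" using assms by (auto simp: p Tri_def)
  define k where "k = nat \<lfloor>(1 - x) / y\<rfloor>"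
  have "0 \<le> (1 - x) / y" using xy by simp
  then have "real k \<le> (1 - x) / y" "(1 - x) / y < real (k + 1)"
    unfolding k_def by linarith+
  then have "real k * y \<le> 1 - x" "1 - x < real (k + 1) * y"
    using xy by (simp_all add: field_simps)
  then have "p \<in> Tri_piece k"
    using assms by (simp add: p Tri_piece_def)
  then show ?thesis using Tri_piece_inj by blast
qed

lemma tri_map_eq:
  assumes "(\<alpha>, \<beta>) \<in> Tri_piece k"
  shows "tri_map (\<alpha>, \<beta>) = (\<beta> / \<alpha>, (1 - \<alpha> - real k * \<beta>) / \<alpha>)"
proof -
  have "(THE k. (\<alpha>, \<beta>) \<in> Tri_piece k) = k"
    using assms Tri_piece_inj by blast
  then show ?thesis by (simp add: tri_map_def)
qed

lemma Cvec_init: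
  "Cvec a (- 3) = vector [1, 0, 0]"
  "Cvec a (- 2) = vector [0, 1, 0]"
  "Cvec a (- 1) = vector [0, 0, 1]"
  by (simp_all add: Cvec_def numeral_2_eq_2)

lemma Cvec_rec:
  "Cvec a (int k) =
     Cvec a (int k - 3) - Cvec a (int k - 2) - real (a k) *\<^sub>R Cvec a (int k - 1)"
proof -
  have "nat (int k + 3) = Suc (Suc (Suc k))" "nat (int k - 3 + 3) = k"
    "nat (int k - 2 + 3) = Suc k" "nat (int k - 1 + 3) = Suc (Suc k)"
    by linarith+
  then show ?thesis unfolding Cvec_def by (simp only: C_shift.simps)
qed

end

theory Submission
  imports Defs
begin

text \<open>
  The product is governed by a scalar averaging process. Write \<open>x\<^sub>n > 0\<close>
  for the first coordinate of \<open>X\<^sub>n\<close>. From \<open>X\<^sub>k = X\<^bsub>k-1\<^esub> + a\<^sub>k X\<^bsub>k-2\<^esub> + X\<^bsub>k-3\<^esub>\<close>, every ratio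
  \<open>r\<^sub>n = (w \<bullet> X\<^sub>n) / x\<^sub>n\<close> is a weighted average of its three predecessors, the weight of the
  middle one being \<open>1 - \<lambda>\<close>; since \<open>a\<^sub>k \<ge> 1\<close>, the oldest one has the least weight.

  If the ratios do not converge, then eventually they alternate between values at least \<open>M\<close> and values
  at most \<open>m < M\<close>, and each step brings neighbours closer by at least \<open>\<lambda> (M - m)\<close>. Hence
  \<open>\<Sum> \<lambda>\<close> converges and the product is positive. Conversely, if the product is positive, start late, where
  the tail product exceeds \<open>3/4\<close>, and choose \<open>w\<close> such that three consecutive ratios are \<open>0, 1, 0\<close>: then
  consecutive ratios remain \<open>1/2\<close> apart, and so do, up to a constant, consecutive vertices of the
  triangles.
\<close>

section \<open>Infinite products and scalar averaging recurrences\<close>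

text \<open>Nonnegative terms with bounded partial sums are summable, so the product converges
  absolutely; such a product vanishes only if some factor does.\<close>

lemma prod_one_minus_not_tendsto_0:
  fixes f :: "nat \<Rightarrow> real"
  assumes f: "\<And>n. 0 \<le> f n" "\<And>n. f n < 1"
    and bound: "\<And>k. (\<Sum>i<k. f (N + i)) \<le> B"
  shows "\<not> (\<lambda>n. \<Prod>i\<le>n. 1 - f i) \<longlonglongrightarrow> 0"
proof
  assume lim0: "(\<lambda>n. \<Prod>i\<le>n. 1 - f i) \<longlonglongrightarrow> 0"
  have "summable (\<lambda>i. f (i + N))"
  proof (rule bounded_imp_summable[where B = B])
    show "0 \<le> f (n + N)" "(\<Sum>i\<le>n. f (i + N)) \<le> B" for n
      using f(1) bound[of "Suc n"] by (simp_all only: lessThan_Suc_atMost add.commute)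
  qed
  then have "summable f" by (simp only: summable_iff_shift)
  then have "summable (\<lambda>i. norm ((1 - f i) - 1))" using f by simp
  then have "abs_convergent_prod (\<lambda>i. 1 - f i)"
    by (rule summable_imp_abs_convergent_prod)
  then have conv: "convergent_prod (\<lambda>i. 1 - f i)"
    by (rule abs_convergent_prod_imp_convergent_prod)
  have "prodinf (\<lambda>i. 1 - f i) = 0"
    using convergent_prod_LIMSEQ[OF conv] lim0 LIMSEQ_unique by blast
  moreover have "prodinf (\<lambda>i. 1 - f i) \<noteq> 0"
  proof (rule prodinf_nonzero[OF conv])
    show "1 - f i \<noteq> 0" for i using f(2)[of i] by simp
  qed
  ultimately show False by contradiction
qed

locale averaging =
  fixes \<alpha> \<beta> \<gamma> r :: "nat \<Rightarrow> real"
  assumes nonneg: "0 \<le> \<alpha> n" "0 \<le> \<gamma> n"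
    and pos: "0 < \<beta> n"
    and sum1: "\<alpha> n + \<beta> n + \<gamma> n = 1"
    and rec: "r (n + 3) = \<alpha> n * r (n + 2) + \<beta> n * r (n + 1) + \<gamma> n * r n"
begin

definition hi :: "nat \<Rightarrow> real" where
  "hi n = max (r n) (max (r (n + 1)) (r (n + 2)))"

definition lo :: "nat \<Rightarrow> real" where
  "lo n = min (r n) (min (r (n + 1)) (r (n + 2)))"

text \<open>Because the weights sum to 1, averaging commutes with the reflection at
  \<open>c\<close>. Every upper bound proved below thus yields the matching lower bound.\<close>

lemma reflect: "averaging \<alpha> \<beta> \<gamma> (\<lambda>n. c - r n)"
proof
  show "c - r (n + 3) = \<alpha> n * (c - r (n + 2)) + \<beta> n * (c - r (n + 1)) + \<gamma> n * (c - r n)" for n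
  proof -
    have "c = (\<alpha> n + \<beta> n + \<gamma> n) * c" by (simp add: sum1)
    then show ?thesis unfolding rec by algebra
  qed
qed (use nonneg pos sum1 in auto)

lemma le_hi: "r n \<le> hi n" "r (n + 1) \<le> hi n" "r (n + 2) \<le> hi n"
  by (auto simp: hi_def)

lemma rec_le:
  assumes "r n \<le> c" "r (n + 1) \<le> c" "r (n + 2) \<le> c"
  shows "r (n + 3) \<le> c"
proof -
  have "r (n + 3) \<le> \<alpha> n * c + \<beta> n * c + \<gamma> n * c"
    unfolding rec using assms nonneg pos[of n]
    by (intro add_mono mult_left_mono) auto
  also have "\<dots> = c" using sum1[of n] by (metis distrib_right mult_1)
  finally show ?thesis .
qed

lemma hi_Suc: "hi (Suc n) \<le> hi n"
proof -
  have "r (n + 3) \<le> hi n" by (intro rec_le le_hi)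
  then show ?thesis using le_hi[of n] 
    by (simp add: hi_def[of "Suc n"] numeral_3_eq_3 numeral_2_eq_2)
qed

lemma lo_eq: "lo n = - averaging.hi (\<lambda>n. 0 - r n) n"
  unfolding averaging.hi_def[OF reflect] by (simp add: lo_def min_def max_def)

lemma lo_Suc: "lo n \<le> lo (Suc n)"
  using averaging.hi_Suc[OF reflect[of 0], of n] by (simp add: lo_eq)

lemma lo_le: "lo n \<le> r n" "lo n \<le> r (n + 1)" "lo n \<le> r (n + 2)"
  by (auto simp: lo_def)

lemma rec_ge:
  assumes "c \<le> r n" "c \<le> r (n + 1)" "c \<le> r (n + 2)"
  shows "c \<le> r (n + 3)"
  using averaging.rec_le[OF reflect[of 0], of n "- c"] assms by simp

lemma r_le:
  assumes "r k \<le> c" "r (k + 1) \<le> c" "r (k + 2) \<le> c" "k \<le> n"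
  shows "r n \<le> c"
proof -
  have "hi n \<le> hi k" using lift_Suc_antimono_le[of hi, OF hi_Suc assms(4)] .
  moreover have "hi k \<le> c" using assms by (simp add: hi_def)
  ultimately show ?thesis using le_hi(1)[of n] by linarith
qed

lemma r_ge:
  assumes "c \<le> r k" "c \<le> r (k + 1)" "c \<le> r (k + 2)" "k \<le> n"
  shows "c \<le> r n"
  using averaging.r_le[OF reflect[of 0], of k "- c" n] assms by simp

text \<open>From \<open>N\<close> on all values lie in the unit interval, so
  \<open>r (n + 3)\<close> keeps at least the fraction \<open>\<beta> n\<close> of
  \<open>r (n + 1)\<close>, and likewise for the complements to 1. Both losses are controlled by the
  partial products, and 3/4 - (1 - 3/4) = 1/2.\<close>

lemma separation:
  assumes "r N = 0" "r (N + 1) = 1" "r (N + 2) = 0"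
    and Q: "\<And>k. 3 / 4 \<le> (\<Prod>i<k. \<beta> (N + i))"
  shows "1 / 2 \<le> r (N + 2 * j + 1) - r (N + 2 * j + 2)"
proof -
  define Q where "Q k = (\<Prod>i<k. \<beta> (N + i))" for k
  have beta_le: "\<beta> n \<le> 1" for n using nonneg[of n] sum1[of n] by linarith
  have Q0: "0 \<le> Q k" for k unfolding Q_def by (intro prod_nonneg) (simp add: less_imp_le pos)
  have QS: "Q (Suc k) = \<beta> (N + k) * Q k" for k by (simp add: Q_def mult.commute)
  \<comment> \<open>Each chain below uses only every second factor. Dropping the other factor, which
    is at most 1, lets one \<open>Q\<close> bound both chains.\<close>
  have QSS: "Q (Suc (Suc k)) \<le> \<beta> (N + k) * Q k" "Q (Suc (Suc k)) \<le> \<beta> (N + Suc k) * Q k" for k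
  proof -
    show "Q (Suc (Suc k)) \<le> \<beta> (N + k) * Q k"
      using mult_right_mono[OF beta_le[of "N + Suc k"] Q0[of "Suc k"]] by (simp add: QS)
    have "Q (Suc k) \<le> Q k"
      using mult_right_mono[OF beta_le[of "N + k"] Q0[of k]] by (simp add: QS)
    then show "Q (Suc (Suc k)) \<le> \<beta> (N + Suc k) * Q k"
      using pos[of "N + Suc k"] by (simp add: QS[of "Suc k"])
  qed
  have r01: "0 \<le> r n" "r n \<le> 1" if "N \<le> n" for n
    using r_le[of N 1 n] r_ge[of 0 N n] assms that by auto
  have up: "Q (2 * j) \<le> r (N + 2 * j + 1)" for j
  proof (induction j)
    case 0
    then show ?case using assms by (simp add: Q_def)
  next
    case (Suc j)
    let ?n = "N + 2 * j"
    have "Q (2 * Suc j) \<le> \<beta> ?n * Q (2 * j)" using QSS(1)[of "2 * j"] by simp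
    also have "\<dots> \<le> \<beta> ?n * r (?n + 1)"
      using Suc pos[of ?n] by (intro mult_left_mono) auto
    also have "\<dots> \<le> r (?n + 3)"
      unfolding rec using nonneg[of ?n] r01(1)[of "?n + 2"] r01(1)[of ?n] by simp
    finally show ?case by (simp add: numeral_3_eq_3)
  qed
  have down: "Q (2 * j) \<le> 1 - r (N + 2 * j + 2)" for j
  proof (induction j)
    case 0
    then show ?case using assms by (simp add: Q_def)
  next
    case (Suc j)
    let ?n = "N + 2 * j + 1"
    have "Q (2 * Suc j) \<le> \<beta> ?n * Q (2 * j)" using QSS(2)[of "2 * j"] by simp
    also have "\<dots> \<le> \<beta> ?n * (1 - r (?n + 1))"
      using Suc pos[of ?n] by (intro mult_left_mono) auto
    also have "\<dots> \<le> 1 - r (?n + 3)"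
    proof -
      have "1 - r (?n + 3) = \<alpha> ?n * (1 - r (?n + 2)) + \<beta> ?n * (1 - r (?n + 1)) + \<gamma> ?n * (1 - r ?n)"
        by (rule averaging.rec[OF reflect])
      then show ?thesis using nonneg[of ?n] r01(2)[of "?n + 2"] r01(2)[of ?n] by simp
    qed
    finally show ?case by (simp add: numeral_3_eq_3)
  qed
  show ?thesis using up[of j] down[of j] Q[of "2 * j"] unfolding Q_def by linarith
qed

end

locale dominated_averaging = averaging +
  assumes gamma_le: "\<gamma> n \<le> \<alpha> n" "\<gamma> n \<le> \<beta> n"
begin

lemma reflect': "dominated_averaging \<alpha> \<beta> \<gamma> (\<lambda>n. c - r n)"
  by (intro dominated_averaging.intro dominated_averaging_axioms.intro reflect gamma_le)

text \<open>The oldest of the three values carries the least weight, so it cannot pull the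
  average up past the most recent low value.\<close>
lemma no_return:
  assumes r: "r n < M + e" "r (n + 1) \<le> m" "r (n + 2) \<le> M" and e: "0 < e" "m + e < M"
  shows "r (n + 3) < M"
proof -
  have "\<beta> n * r (n + 1) \<le> \<beta> n * m" "\<alpha> n * r (n + 2) \<le> \<alpha> n * M" "\<gamma> n * r n \<le> \<gamma> n * (M + e)"
    using r nonneg[of n] pos[of n] by (auto intro!: mult_left_mono)
  moreover have "\<gamma> n * e \<le> \<beta> n * e" using gamma_le[of n] e by simp
  moreover have "\<beta> n * (m + e) < \<beta> n * M" using pos[of n] e by simp
  moreover have "(\<alpha> n + \<beta> n + \<gamma> n) * M = M" by (simp add: sum1)
  ultimately show ?thesis unfolding rec by (simp add: algebra_simps)
qed

lemma window_shrinks: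
  assumes prod0: "(\<lambda>n. \<Prod>i\<le>n. \<beta> i) \<longlonglongrightarrow> 0"
  shows "(\<lambda>n. hi n - lo n) \<longlonglongrightarrow> 0"
proof -
  have dec: "decseq hi" using hi_Suc by (simp add: decseq_Suc_iff)
  have inc: "incseq lo" using lo_Suc by (simp add: incseq_Suc_iff)
  have lohi: "lo n \<le> hi n" for n using lo_le(1) le_hi(1) order_trans by blast
  have "\<forall>i. lo 0 \<le> hi i"
    using inc lohi by (meson incseqD order_trans zero_le)
  then obtain M where M: "hi \<longlonglongrightarrow> M" "\<And>n. M \<le> hi n"
    using decseq_convergent[OF dec] by metis
  have "\<forall>i. lo i \<le> hi 0"
    using decseqD[OF dec zero_le] lohi order_trans by metis
  then obtain m where m: "lo \<longlonglongrightarrow> m" "\<And>n. lo n \<le> m"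
    using incseq_convergent[OF inc] by metis
  have "m = M"
  proof (rule ccontr)
    assume "m \<noteq> M"
    moreover have "m \<le> M" by (rule LIMSEQ_le[OF m(1) M(1)]) (use lohi in auto)
    ultimately have mM: "m < M" by simp
    \<comment> \<open>Any value strictly between 0 and \<open>M - m\<close> would do; this is what
      \<open>no_return\<close> asks for, both directly and after reflection.\<close>
    define e where "e = (M - m) / 2"
    have e: "0 < e" "m + e < M" "0 - M + e < 0 - m" using mM by (auto simp: e_def field_simps)
    have "eventually (\<lambda>n. hi n < M + e \<and> m - e < lo n) sequentially"
      using e by (intro eventually_conj order_tendstoD[OF M(1)] order_tendstoD[OF m(1)]) auto
    then obtain N where N: "\<And>n. N \<le> n \<Longrightarrow> hi n < M + e \<and> m - e < lo n"
      unfolding eventually_sequentially by blast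
    have range: "r n < M + e" "m - e < r n" if "N \<le> n" for n
      using N[OF that] le_hi(1)[of n] lo_le(1)[of n] by auto
    \<comment> \<open>The window maximum decreases to \<open>M\<close> and the window minimum
      increases to \<open>m\<close>, so every window of three has a value at least \<open>M\<close>
      and one at most \<open>m\<close>.\<close>
    have high: "M \<le> r n \<or> M \<le> r (n + 1) \<or> M \<le> r (n + 2)" for n
      using M(2)[of n] by (auto simp: hi_def le_max_iff_disj)
    have low: "r n \<le> m \<or> r (n + 1) \<le> m \<or> r (n + 2) \<le> m" for n
      using m(2)[of n] by (auto simp: lo_def min_le_iff_disj)
    interpret neg: dominated_averaging \<alpha> \<beta> \<gamma> "\<lambda>n. 0 - r n" by (rule reflect')
    have return_low: "r (n + 3) < M" if "N \<le> n" "r (n + 1) \<le> m" "r (n + 2) \<le> M" for n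
      using no_return[OF range(1)[OF that(1)] that(2,3)] e by simp
    have return_high: "m < r (n + 3)" if "N \<le> n" "M \<le> r (n + 1)" "m \<le> r (n + 2)" for n
      using neg.no_return[of n "0 - m" e "0 - M"] range(2)[OF that(1)] that e by simp
    \<comment> \<open>A value strictly between \<open>m\<close> and \<open>M\<close> would leave the
      high and the low value of its window to its two neighbours, on opposite sides, and
      \<open>no_return\<close> forbids either order.\<close>
    have extreme: "r (n + 2) \<le> m \<or> M \<le> r (n + 2)" if n: "N \<le> n" for n
    proof (rule ccontr)
      assume mid: "\<not> ?thesis"
      have "r (n + 1) \<le> m \<and> M \<le> r (n + 3) \<or> M \<le> r (n + 1) \<and> r (n + 3) \<le> m"
        using high[of "n + 1"] low[of "n + 1"] mid mM
        by (auto simp: numeral_3_eq_3 numeral_2_eq_2)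
      then show False using return_low[OF n] return_high[OF n] mid by force
    qed
    \<comment> \<open>Two neighbours on the same side would force the next value to the other side,
      again contradicting \<open>no_return\<close>.\<close>
    have alternate: "r (n + 1) \<le> m \<and> M \<le> r (n + 2) \<or> M \<le> r (n + 1) \<and> r (n + 2) \<le> m"
      if n: "N + 1 \<le> n" for n
    proof -
      have "r (n + 1) \<le> m \<or> M \<le> r (n + 1)" "r (n + 2) \<le> m \<or> M \<le> r (n + 2)"
        using extreme[of "n - 1"] extreme[of n] n by (auto simp: numeral_2_eq_2)
      moreover have "\<not> (r (n + 1) \<le> m \<and> r (n + 2) \<le> m)"
      proof
        assume *: "r (n + 1) \<le> m \<and> r (n + 2) \<le> m"
        then have "r (n + 3) < M" using return_low[of n] n mM by auto
        then show False using * high[of "n + 1"] mM by (auto simp: numeral_3_eq_3 numeral_2_eq_2)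
      qed
      moreover have "\<not> (M \<le> r (n + 1) \<and> M \<le> r (n + 2))"
      proof
        assume *: "M \<le> r (n + 1) \<and> M \<le> r (n + 2)"
        then have "m < r (n + 3)" using return_high[of n] n mM by auto
        then show False using * low[of "n + 1"] mM by (auto simp: numeral_3_eq_3 numeral_2_eq_2)
      qed
      ultimately show ?thesis by blast
    qed
    define s where "s n = \<bar>r (n + 2) - r (n + 1)\<bar>" for n
    \<comment> \<open>Both \<open>r n\<close> and \<open>r (n + 2)\<close> lie across the gap from
      \<open>r (n + 1)\<close>. They pull \<open>r (n + 3)\<close> away from
      \<open>r (n + 1)\<close> towards themselves by at least
      \<open>(\<alpha> n + \<gamma> n) * (M - m)\<close>, while it stays on the side of
      \<open>r (n + 1)\<close>.\<close>
    have drop: "s (Suc n) \<le> s n - (1 - \<beta> n) * (M - m)" if n: "N + 2 \<le> n" for n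
    proof -
      have a0: "r n \<le> m \<and> M \<le> r (n + 1) \<or> M \<le> r n \<and> r (n + 1) \<le> m"
        using alternate[of "n - 1"] n by (auto simp: numeral_2_eq_2)
      have a1: "r (n + 1) \<le> m \<and> M \<le> r (n + 2) \<or> M \<le> r (n + 1) \<and> r (n + 2) \<le> m"
        using alternate[of n] n by auto
      have a2: "r (n + 2) \<le> m \<and> M \<le> r (n + 3) \<or> M \<le> r (n + 2) \<and> r (n + 3) \<le> m"
        using alternate[of "Suc n"] n by (auto simp: numeral_2_eq_2 numeral_3_eq_3)
      have diff: "r (n + 3) - r (n + 1) = \<alpha> n * (r (n + 2) - r (n + 1)) + \<gamma> n * (r n - r (n + 1))"
      proof -
        have "(\<alpha> n + \<beta> n + \<gamma> n) * r (n + 1) = r (n + 1)" by (simp add: sum1)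
        then show ?thesis unfolding rec by (simp add: algebra_simps)
      qed
      have b: "1 - \<beta> n = \<alpha> n + \<gamma> n" using sum1[of n] by simp
      have s: "s n = \<bar>r (n + 2) - r (n + 1)\<bar>" "s (Suc n) = \<bar>r (n + 3) - r (n + 2)\<bar>"
        by (simp_all add: s_def numeral_3_eq_3 numeral_2_eq_2)
      show ?thesis
      proof (cases "M \<le> r (n + 1)")
        case True
        then have *: "r n \<le> m" "r (n + 2) \<le> m" "M \<le> r (n + 3)" using a0 a1 a2 mM by auto
        have "\<alpha> n * (M - m) \<le> \<alpha> n * (r (n + 1) - r (n + 2))"
          "\<gamma> n * (M - m) \<le> \<gamma> n * (r (n + 1) - r n)"
          using * True nonneg[of n] by (auto intro!: mult_left_mono)
        then have "r (n + 3) - r (n + 1) \<le> - ((1 - \<beta> n) * (M - m))"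
          unfolding diff b by (simp add: algebra_simps)
        then show ?thesis unfolding s using * True mM by linarith
      next
        case False
        then have *: "M \<le> r n" "M \<le> r (n + 2)" "r (n + 3) \<le> m" "r (n + 1) \<le> m" using a0 a1 a2 mM by auto
        have "\<alpha> n * (M - m) \<le> \<alpha> n * (r (n + 2) - r (n + 1))"
          "\<gamma> n * (M - m) \<le> \<gamma> n * (r n - r (n + 1))"
          using * nonneg[of n] by (auto intro!: mult_left_mono)
        then have "(1 - \<beta> n) * (M - m) \<le> r (n + 3) - r (n + 1)"
          unfolding diff b by (simp add: algebra_simps)
        then show ?thesis unfolding s using * mM by linarith
      qed
    qed
    \<comment> \<open>Telescoping \<open>drop\<close>; as \<open>s\<close> is nonnegative, this
      bounds the partial sums of \<open>1 - \<beta>\<close>.\<close>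
    have total: "(\<Sum>i<k. 1 - \<beta> (N + 2 + i)) * (M - m) \<le> s (N + 2) - s (N + 2 + k)" for k
    proof (induction k)
      case (Suc k)
      then show ?case using drop[of "N + 2 + k"] by (simp add: algebra_simps)
    qed simp
    have "\<not> (\<lambda>n. \<Prod>i\<le>n. 1 - (1 - \<beta> i)) \<longlonglongrightarrow> 0"
    proof (rule prod_one_minus_not_tendsto_0)
      show "0 \<le> 1 - \<beta> n" "1 - \<beta> n < 1" for n
        using pos[of n] nonneg[of n] sum1[of n] by linarith+
      show "(\<Sum>i<k. 1 - \<beta> (N + 2 + i)) \<le> s (N + 2) / (M - m)" for k
      proof -
        have "0 \<le> s (N + 2 + k)" by (simp add: s_def)
        then show ?thesis using total[of k] mM by (simp add: pos_le_divide_eq)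
      qed
    qed
    then show False using prod0 by simp
  qed
  then show ?thesis using tendsto_diff[OF M(1) m(1)] by simp
qed

end

section \<open>The vectors X, their denominators and the averaging weights\<close>

text \<open>The shift starts at X with index -2: it is the oldest vector occurring in
  \<open>lam\<close>, whereas the vector with index -3 has first coordinate 0.\<close>

definition xv :: "(nat \<Rightarrow> nat) \<Rightarrow> nat \<Rightarrow> real ^ 3" where
  "xv a n = Xvec a (int n - 2)"

lemma xv_eq: "xv a n = cross3 (C_shift a (Suc n)) (C_shift a (Suc (Suc n)))"
proof -
  have "nat (int n - 2 + 3) = Suc n" "nat (int n - 2 + 1 + 3) = Suc (Suc n)" by linarith+
  then show ?thesis by (simp add: xv_def Xvec_def Cvec_def)
qed

lemma Xvec_xv:
  "Xvec a (int n - 1) = xv a (n + 1)" "Xvec a (int n + 1) = xv a (n + 3)"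
  "Xvec a (int n) = xv a (n + 2)" "Xvec a (int n - 2) = xv a n"
  by (simp_all add: xv_def add.commute)

text \<open>Expand the newest cross product bilinearly. The coefficient \<open>l\<close> disappears
  because the cross product of a vector with itself is 0, so a single coefficient survives.\<close>

lemma xv_rec: "xv a (n + 3) = xv a (n + 2) + real (a (Suc n)) *\<^sub>R xv a (n + 1) + xv a n"
proof -
  have cross: "cross3 (u - v - k *\<^sub>R w) (v - w - l *\<^sub>R (u - v - k *\<^sub>R w)) =
      cross3 w (u - v - k *\<^sub>R w) + k *\<^sub>R cross3 v w + cross3 u v" for u v w :: "real^3" and k l
    by (simp add: vec_eq_iff forall_3 cross3_def algebra_simps)
  define u v w where "u = C_shift a (Suc n)" and "v = C_shift a (Suc (Suc n))"
    and "w = C_shift a (Suc (Suc (Suc n)))"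
  have "C_shift a (Suc (Suc (Suc (Suc n)))) = u - v - real (a (Suc n)) *\<^sub>R w"
    "C_shift a (Suc (Suc (Suc (Suc (Suc n))))) =
      v - w - real (a (Suc (Suc n))) *\<^sub>R (u - v - real (a (Suc n)) *\<^sub>R w)"
    unfolding u_def v_def w_def by (simp_all only: C_shift.simps)
  then show ?thesis
    unfolding xv_eq numeral_3_eq_3 numeral_2_eq_2 One_nat_def add_Suc_right add_0_right
    by (simp only: cross flip: u_def v_def w_def)
qed

lemma xv_init:
  "xv a 0 = vector [1, 0, 0]" "xv a (Suc 0) = vector [1, 1, 0]"
  "xv a (Suc (Suc 0)) = vector [1 + real (a 0), 1, 1]"
  by (simp_all add: xv_eq vec_eq_iff forall_3 cross3_def algebra_simps)

text \<open>The recurrence adds multiples of two rows to the third and permutes the rows cyclically,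
  so the determinant keeps its initial value.\<close>

lemma xv_det: "xv a n \<bullet> cross3 (xv a (n + 1)) (xv a (n + 2)) = 1"
proof (induction n)
  case 0
  then show ?case
    by (simp add: xv_init numeral_2_eq_2 cross3_def inner_vec_def sum_3)
next
  case (Suc n)
  have "v \<bullet> cross3 w (w + k *\<^sub>R v + u) = u \<bullet> cross3 v w" for u v w :: "real^3" and k
    by (simp add: cross3_def inner_vec_def sum_3 algebra_simps)
  then show ?case using Suc xv_rec[of a n] by (simp add: numeral_3_eq_3 numeral_2_eq_2)
qed

definition den :: "(nat \<Rightarrow> nat) \<Rightarrow> nat \<Rightarrow> real" where
  "den a n = xv a n $ 1"

lemma den_rec: "den a (n + 3) = den a (n + 2) + real (a (Suc n)) * den a (n + 1) + den a n"
  by (simp add: den_def xv_rec)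

lemma den_pos_mono: "0 < den a n \<and> den a n \<le> den a (n + 1) \<and> den a (n + 1) \<le> den a (n + 2)"
proof (induction n)
  case 0
  then show ?case by (simp add: den_def xv_init numeral_2_eq_2)
next
  case (Suc n)
  then show ?case using den_rec[of a n] by (simp add: numeral_3_eq_3 numeral_2_eq_2)
qed

lemma den_pos [simp]: "0 < den a n"
  using den_pos_mono by blast

lemma den_nonzero [simp]: "den a n \<noteq> 0"
  using den_pos[of a n] by linarith

lemma den_nonneg [simp]: "0 \<le> den a n"
  using den_pos[of a n] by linarith

text \<open>The middle coefficient of \<open>den_rec\<close> after normalisation;
  \<open>lam_eq\<close> identifies it with \<open>1 - lam a n\<close>.\<close>

definition weight :: "(nat \<Rightarrow> nat) \<Rightarrow> nat \<Rightarrow> real" where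
  "weight a n = real (a (Suc n)) * den a (n + 1) / den a (n + 3)"

text \<open>The affine function with coefficients \<open>w\<close>, evaluated at the vertex
  \<open>proj_hat (xv a n)\<close>; see \<open>ratio_eq\<close>.\<close>

definition ratio :: "(nat \<Rightarrow> nat) \<Rightarrow> real ^ 3 \<Rightarrow> nat \<Rightarrow> real" where
  "ratio a w n = (w \<bullet> xv a n) / den a n"

lemma ratio_eq:
  "ratio a w n = w $ 1 + w $ 2 * fst (proj_hat (xv a n)) + w $ 3 * snd (proj_hat (xv a n))"
proof -
  have "xv a n $ 1 \<noteq> 0" using den_nonzero[of a n] by (simp add: den_def)
  then show ?thesis by (simp add: ratio_def den_def proj_hat_def inner_vec_def sum_3 field_simps)
qed

text \<open>Dividing the recurrence by \<open>den a (n + 3)\<close> gives the weights. Monotone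
  denominators compare the oldest weight with the newest; with nonzero \<open>a\<close> they also
  compare it with the middle one.\<close>

lemma ratio_dominated_averaging:
  assumes "\<And>n. a n \<noteq> 0"
  shows "dominated_averaging (\<lambda>n. den a (n + 2) / den a (n + 3)) (weight a)
    (\<lambda>n. den a n / den a (n + 3)) (ratio a w)"
proof
  fix n
  have a: "1 \<le> real (a (Suc n))" using assms[of "Suc n"] by simp
  note mono = den_pos_mono[of a n]
  show "0 \<le> den a (n + 2) / den a (n + 3)" "0 \<le> den a n / den a (n + 3)" by simp_all
  show "0 < weight a n" using a by (simp add: weight_def)
  show "den a (n + 2) / den a (n + 3) + weight a n + den a n / den a (n + 3) = 1"
  proof -
    have "den a (n + 2) / den a (n + 3) + weight a n + den a n / den a (n + 3) =
        den a (n + 3) / den a (n + 3)"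
      unfolding weight_def add_divide_distrib[symmetric] den_rec[symmetric] ..
    then show ?thesis by simp
  qed
  show "den a n / den a (n + 3) \<le> den a (n + 2) / den a (n + 3)"
    using mono by (intro divide_right_mono) auto
  have "den a n \<le> 1 * den a (n + 1)" using mono by simp
  also have "\<dots> \<le> real (a (Suc n)) * den a (n + 1)" using a by (intro mult_right_mono) auto
  finally show "den a n / den a (n + 3) \<le> weight a n"
    unfolding weight_def by (intro divide_right_mono) auto
  show "ratio a w (n + 3) = den a (n + 2) / den a (n + 3) * ratio a w (n + 2) +
      weight a n * ratio a w (n + 1) + den a n / den a (n + 3) * ratio a w n"
  proof -
    have "w \<bullet> xv a (n + 3) = w \<bullet> xv a (n + 2) + real (a (Suc n)) * (w \<bullet> xv a (n + 1)) + w \<bullet> xv a n"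
      by (simp only: xv_rec inner_add_right inner_scaleR_right)
    then show ?thesis by (simp add: ratio_def weight_def add_divide_distrib)
  qed
qed

text \<open>Equality would make three consecutive vectors linearly dependent, against
  \<open>xv_det\<close>. Hence the denominator of \<open>lam\<close> is not 0.\<close>

lemma proj_hat_neq_hat_add: "proj_hat (xv a (n + 1)) \<noteq> hat_add (xv a (n + 2)) (xv a n)"
proof
  let ?s = "den a (n + 2) + den a n" and ?V = "xv a (n + 2) + xv a n"
  assume eq: "proj_hat (xv a (n + 1)) = hat_add (xv a (n + 2)) (xv a n)"
  have pos: "0 < ?s" using den_pos add_pos_pos by blast
  have "?V = (?s / den a (n + 1)) *\<^sub>R xv a (n + 1)"
    using eq pos den_nonzero[of a "n + 1"]
    by (auto simp: proj_hat_def hat_add_def vec_eq_iff forall_3 den_def field_simps)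
  then have "xv a n = (?s / den a (n + 1)) *\<^sub>R xv a (n + 1) - xv a (n + 2)"
    by (simp add: algebra_simps)
  then have "xv a n \<bullet> cross3 (xv a (n + 1)) (xv a (n + 2)) = 0"
    by (simp only: inner_diff_left inner_scaleR_left dot_cross_self mult_zero_right diff_0_right)
  then show False using xv_det[of a n] by simp
qed

text \<open>By the recurrence, the new vertex lies on the segment from \<open>?A\<close> to
  \<open>?C\<close>, and the first coordinates determine in which proportion it divides it.\<close>

lemma lam_eq: "1 - lam a n = weight a n"
proof -
  let ?s = "den a (n + 2) + den a n"
  let ?A = "proj_hat (xv a (n + 1))" and ?C = "hat_add (xv a (n + 2)) (xv a n)"
  have pos: "0 < ?s" using den_pos add_pos_pos by blast
  have comb: "(t + k * y) / (s + k * x) - y / x = s / (s + k * x) * (t / s - y / x)"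
    if "s \<noteq> 0" "x \<noteq> 0" "s + k * x \<noteq> 0" for s t k x y :: real
    using that by (simp add: divide_simps) (simp add: algebra_simps)
  have nz: "?s + real (a (Suc n)) * den a (n + 1) \<noteq> 0"
    using den_nonzero[of a "n + 3"] unfolding den_rec by (simp add: algebra_simps)
  have d: "den a (n + 3) = ?s + real (a (Suc n)) * den a (n + 1)"
    by (simp add: den_rec)
  have step: "proj_hat (xv a (n + 3)) - ?A = (?s / den a (n + 3)) *\<^sub>R (?C - ?A)"
  proof (rule prod_eqI)
    have "xv a (n + 3) $ i / den a (n + 3) - xv a (n + 1) $ i / den a (n + 1) =
      ?s / den a (n + 3) * ((xv a (n + 2) $ i + xv a n $ i) / ?s - xv a (n + 1) $ i / den a (n + 1))" for i
      using comb[OF less_imp_neq[OF pos, symmetric] den_nonzero nz, of "xv a (n + 2) $ i + xv a n $ i" "xv a (n + 1) $ i"]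
      by (simp add: d xv_rec add_ac)
    then show "fst (proj_hat (xv a (n + 3)) - ?A) = fst ((?s / den a (n + 3)) *\<^sub>R (?C - ?A))"
      "snd (proj_hat (xv a (n + 3)) - ?A) = snd ((?s / den a (n + 3)) *\<^sub>R (?C - ?A))"
      by (simp_all add: proj_hat_def hat_add_def flip: den_def)
  qed
  have "dist (proj_hat (xv a (n + 3))) ?A = ?s / den a (n + 3) * dist ?C ?A"
    unfolding dist_norm step norm_scaleR using pos by simp
  then have "dist ?A (proj_hat (xv a (n + 3))) = ?s / den a (n + 3) * dist ?A ?C"
    by (simp only: dist_commute)
  then have "lam a n = ?s / den a (n + 3)"
    using proj_hat_neq_hat_add[of a n] by (simp add: lam_def Xvec_xv)
  then show ?thesis
    using den_nonzero[of a "n + 3"] by (simp add: weight_def d field_simps)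
qed

section \<open>The triangle map and the triangles in homogeneous coordinates\<close>

lemma tri_map_piece:
  assumes "p \<in> Tri_piece k"
  shows "tri_map p = (snd p / fst p, (1 - fst p - real k * snd p) / fst p)"
  using tri_map_eq[of "fst p" "snd p" k] assms by simp

text \<open>The bound 0 is not strict: the edge \<open>1 - x - k * y = 0\<close> of a piece is sent
  to second coordinate 0, outside \<open>Tri\<close>.\<close>

lemma tri_map_image:
  assumes "p \<in> Tri_piece k"
  shows "0 \<le> snd (tri_map p)" "snd (tri_map p) \<le> fst (tri_map p)" "fst (tri_map p) \<le> 1" "0 < fst p"
proof -
  have p: "0 < snd p" "snd p \<le> fst p" "0 \<le> 1 - fst p - real k * snd p"
    "1 - fst p - real (k + 1) * snd p < 0"
    using assms by (auto simp: Tri_piece_def Tri_def)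
  then show *: "0 < fst p" by simp
  have "1 - fst p - real k * snd p \<le> snd p" using p(4) by (simp add: algebra_simps)
  with p * show "0 \<le> snd (tri_map p)" "snd (tri_map p) \<le> fst (tri_map p)" "fst (tri_map p) \<le> 1"
    by (simp_all add: tri_map_piece[OF assms] divide_right_mono)
qed

text \<open>In homogeneous coordinates, \<open>chart a n q\<close> is the point of \<open>Tri_seq a n\<close> that the
  \<open>n + 1\<close>-st iterate of the triangle map sends to \<open>q\<close>.\<close>
definition chart :: "(nat \<Rightarrow> nat) \<Rightarrow> nat \<Rightarrow> real \<times> real \<Rightarrow> real ^ 3" where
  "chart a n q = (1 - fst q) *\<^sub>R xv a (n + 1) + fst q *\<^sub>R xv a (n + 2) + snd q *\<^sub>R xv a n"

text \<open>\<open>xv_rec\<close> replaces \<open>xv a (n + 3)\<close>, and its coefficient cancels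
  against the one in \<open>tri_map\<close>. The factor \<open>fst q\<close> is the denominator of
  \<open>tri_map\<close>.\<close>

lemma chart_step:
  assumes "q \<in> Tri_piece (a (Suc n))"
  shows "chart a n q = fst q *\<^sub>R chart a (Suc n) (tri_map q)"
proof -
  obtain s t where q: "q = (s, t)" by (cases q)
  have s: "s \<noteq> 0" using tri_map_image(4)[OF assms] q by simp
  have "tri_map (s, t) = (t / s, (1 - s - real (a (Suc n)) * t) / s)"
    using tri_map_piece[OF assms] by (simp add: q)
  then have "chart a (Suc n) (tri_map q) =
    (1 - t / s) *\<^sub>R xv a (n + 2) + (t / s) *\<^sub>R xv a (n + 3) +
    ((1 - s - real (a (Suc n)) * t) / s) *\<^sub>R xv a (n + 1)"
    by (simp add: chart_def q numeral_3_eq_3 numeral_2_eq_2)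
  also have "s *\<^sub>R \<dots> = chart a n q"
    unfolding chart_def xv_rec using s by (simp add: q vec_eq_iff field_simps)
  finally show ?thesis by (simp add: q)
qed

lemma chart_0:
  assumes "q \<in> Tri_piece (a 0)"
  shows "vector [1, fst q, snd q] = fst q *\<^sub>R chart a 0 (tri_map q)"
  using tri_map_image(4)[OF assms]
  by (simp add: chart_def tri_map_piece[OF assms] xv_init numeral_2_eq_2
      vec_eq_iff forall_3 field_simps)

lemma Tri_seq_Suc:
  "p \<in> Tri_seq a (Suc n) \<longleftrightarrow>
    p \<in> Tri_seq a n \<and> (tri_map ^^ Suc n) p \<in> Tri_piece (a (Suc n))"
  by (auto simp: Tri_seq_def le_Suc_eq)

lemma Tri_seq_chart:
  assumes "p \<in> Tri_seq a n"
  shows "\<exists>c>0. vector [1, fst p, snd p] = c *\<^sub>R chart a n ((tri_map ^^ Suc n) p)"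
  using assms
proof (induction n)
  case 0
  then have p: "p \<in> Tri_piece (a 0)" by (simp add: Tri_seq_def)
  then show ?case using chart_0[of p a] p tri_map_image(4)[OF p] by auto
next
  case (Suc n)
  let ?q = "(tri_map ^^ Suc n) p"
  from Suc obtain c where c: "c > 0" "vector [1, fst p, snd p] = c *\<^sub>R chart a n ?q"
    and q: "?q \<in> Tri_piece (a (Suc n))"
    unfolding Tri_seq_Suc by blast
  have "vector [1, fst p, snd p] = (c * fst ?q) *\<^sub>R chart a (Suc n) ((tri_map ^^ Suc (Suc n)) p)"
    using c(2) chart_step[of ?q a n] q by simp
  moreover have "0 < c * fst ?q" using c(1) tri_map_image(4)[OF q] by (rule mult_pos_pos)
  ultimately show ?case by blast
qed

text \<open>Up to a positive factor, \<open>chart\<close> is a combination of the three vertex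
  vectors with nonnegative coefficients, so an affine bound at the vertices extends to the
  triangle.\<close>

lemma Tri_seq_inner_le:
  assumes p: "p \<in> Tri_seq a n"
    and w: "ratio a w n \<le> d" "ratio a w (n + 1) \<le> d" "ratio a w (n + 2) \<le> d"
  shows "w \<bullet> vector [1, fst p, snd p] \<le> d"
proof -
  let ?q = "(tri_map ^^ Suc n) p" and ?v = "vector [1, fst p, snd p] :: real ^ 3"
  have "(tri_map ^^ n) p \<in> Tri_piece (a n)" using p by (simp add: Tri_seq_def)
  from tri_map_image[OF this] have q: "0 \<le> snd ?q" "fst ?q \<le> 1" "0 \<le> fst ?q" by simp_all
  obtain c where c: "c > 0" "?v = c *\<^sub>R chart a n ?q" using Tri_seq_chart[OF p] by blast
  \<comment> \<open>Absorbing \<open>d\<close> into the constant term makes the bound homogeneous,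
    hence invariant under positive scaling.\<close>
  define u where "u = w - d *\<^sub>R axis 1 (1::real)"
  have u: "u \<bullet> v = w \<bullet> v - d * v $ 1" for v
    by (simp add: u_def inner_diff_left inner_axis' )
  have neg: "u \<bullet> xv a n \<le> 0" "u \<bullet> xv a (n + 1) \<le> 0" "u \<bullet> xv a (n + 2) \<le> 0"
    using w by (simp_all add: u ratio_def pos_divide_le_eq flip: den_def)
  have "u \<bullet> chart a n ?q \<le> 0"
    unfolding chart_def inner_add_right inner_scaleR_right
    using q neg by (intro add_nonpos_nonpos mult_nonneg_nonpos) auto
  then have "u \<bullet> ?v \<le> 0" using c by (simp add: mult_nonneg_nonpos)
  then show ?thesis by (simp add: u)
qed

lemma inner_Tri_seq_diff_le:
  assumes "dominated_averaging \<alpha> \<beta> \<gamma> (ratio a w)" and pq: "p \<in> Tri_seq a n" "q \<in> Tri_seq a n"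
  shows "\<bar>w \<bullet> vector [1, fst p, snd p] - w \<bullet> vector [1, fst q, snd q]\<bar> \<le>
    averaging.hi (ratio a w) n - averaging.lo (ratio a w) n"
proof -
  interpret dominated_averaging \<alpha> \<beta> \<gamma> "ratio a w" by fact
  have neg: "ratio a (- w) k = - ratio a w k" for k by (simp add: ratio_def)
  have "w \<bullet> vector [1, fst p, snd p] \<le> hi n" "lo n \<le> w \<bullet> vector [1, fst p, snd p]"
    if "p \<in> Tri_seq a n" for p
    using Tri_seq_inner_le[OF that le_hi] Tri_seq_inner_le[OF that, of "- w" "- lo n"] lo_le[of n]
    by (simp_all add: neg)
  from this[OF pq(1)] this[OF pq(2)] show ?thesis by linarith
qed

lemma bounded_Tri_seq: "bounded (Tri_seq a n)"
proof (rule bounded_subset)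
  show "bounded (cbox (0, 0) (1, 1) :: (real \<times> real) set)" by (rule bounded_cbox)
  show "Tri_seq a n \<subseteq> cbox (0, 0) (1, 1)"
    by (auto simp: Tri_seq_def Tri_def cbox_Pair_eq)
qed

lemma Tri_piece_preimage:
  assumes "0 < t" "t < s" "s < 1"
  shows "\<exists>s' t'. 0 < t' \<and> t' < s' \<and> s' < 1 \<and> (s', t') \<in> Tri_piece k \<and> tri_map (s', t') = (s, t)"
proof -
  \<comment> \<open>Solving \<open>y / x = s\<close> and \<open>(1 - x - k * y) / x = t\<close>
    gives \<open>1 / x = D\<close> and \<open>y = s / D\<close>.\<close>
  define D where "D = 1 + real k * s + t"
  have D: "1 < D" using assms by (simp add: D_def add_strict_increasing2 add_nonneg_pos)
  have in_piece: "(1 / D, s / D) \<in> Tri_piece k"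
    using assms D by (auto simp: Tri_piece_def Tri_def field_simps) (auto simp: D_def algebra_simps)
  moreover have "tri_map (1 / D, s / D) = (s, t)"
    using D by (simp add: tri_map_piece[OF in_piece] field_simps) (simp add: D_def algebra_simps)
  ultimately show ?thesis
    using assms D by (intro exI[of _ "1 / D"] exI[of _ "s / D"]) (auto simp: field_simps)
qed

text \<open>The inverse branches map the open triangle into itself, so they can be composed.\<close>

lemma Tri_seq_preimage:
  assumes "0 < t" "t < s" "s < 1"
  shows "\<exists>p\<in>Tri_seq a n. (tri_map ^^ Suc n) p = (s, t)"
  using assms
proof (induction n arbitrary: s t)
  case 0
  then obtain p where "p \<in> Tri_piece (a 0)" "tri_map p = (s, t)"
    using Tri_piece_preimage by blast
  then show ?case by (auto simp: Tri_seq_def Tri_piece_def intro!: bexI[of _ p])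
next
  case (Suc n)
  obtain s' t' where st: "0 < t'" "t' < s'" "s' < 1"
    and piece: "(s', t') \<in> Tri_piece (a (Suc n))" and map: "tri_map (s', t') = (s, t)"
    using Tri_piece_preimage[OF Suc.prems] by blast
  obtain p where p: "p \<in> Tri_seq a n" "(tri_map ^^ Suc n) p = (s', t')"
    using Suc.IH[OF st] by blast
  show ?case
  proof (rule bexI)
    show "p \<in> Tri_seq a (Suc n)" unfolding Tri_seq_Suc p(2) using p(1) piece by (rule conjI)
    show "(tri_map ^^ Suc (Suc n)) p = (s, t)"
      unfolding funpow.simps(2)[of "Suc n"] o_apply p(2) by (rule map)
  qed
qed

text \<open>\<open>Tri_seq_preimage\<close> supplies a point over \<open>(s, t)\<close>, and
  \<open>Tri_seq_chart\<close> identifies it with \<open>chart\<close> up to a factor that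
  \<open>proj_hat\<close> removes.\<close>

lemma proj_hat_chart_in_Tri_seq:
  assumes "0 < t" "t < s" "s < 1"
  shows "proj_hat (chart a n (s, t)) \<in> Tri_seq a n"
proof -
  obtain p where p: "p \<in> Tri_seq a n" "(tri_map ^^ Suc n) p = (s, t)"
    using Tri_seq_preimage[OF assms] by blast
  obtain c where c: "c > 0" "vector [1, fst p, snd p] = c *\<^sub>R chart a n (s, t)"
    using Tri_seq_chart[OF p(1)] unfolding p(2) by blast
  have "1 = c * chart a n (s, t) $ 1" "fst p = c * chart a n (s, t) $ 2" "snd p = c * chart a n (s, t) $ 3"
    using arg_cong[OF c(2), of "\<lambda>v. v $ 1"] arg_cong[OF c(2), of "\<lambda>v. v $ 2"]
      arg_cong[OF c(2), of "\<lambda>v. v $ 3"] by simp_all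
  then have "proj_hat (chart a n (s, t)) = p"
    by (cases "chart a n (s, t) $ 1 = 0") (auto simp: proj_hat_def prod_eq_iff field_simps)
  then show ?thesis using p(1) by simp
qed

lemma tendsto_proj_hat:
  assumes "(f \<longlongrightarrow> V) F" "V $ 1 \<noteq> 0"
  shows "((\<lambda>x. proj_hat (f x)) \<longlongrightarrow> proj_hat V) F"
  unfolding proj_hat_def using assms
  by (intro tendsto_Pair tendsto_divide tendsto_vec_nth) auto

lemma dist_proj_hat_le_diameter:
  "dist (proj_hat (xv a (n + 1))) (proj_hat (xv a (n + 2))) \<le> diameter (Tri_seq a n)"
proof -
  \<comment> \<open>The vertices are approached from the interior, along parameters tending to (0,
    0) and (1, 0). The bound 1/3 keeps both parameter points in the open triangle.\<close>
  define h where "h j = inverse (real (Suc (j + 2)))" for j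
  have h: "0 < h j" "h j \<le> 1 / 3" for j by (auto simp: h_def field_simps)
  have h0: "h \<longlonglongrightarrow> 0"
    unfolding h_def using LIMSEQ_ignore_initial_segment[OF LIMSEQ_inverse_real_of_nat, of 2] by simp
  let ?P = "\<lambda>j. proj_hat (chart a n (2 * h j, h j))"
  let ?Q = "\<lambda>j. proj_hat (chart a n (1 - h j, h j))"
  have "?P \<longlonglongrightarrow> proj_hat (xv a (n + 1))"
  proof (rule tendsto_proj_hat)
    show "(\<lambda>j. chart a n (2 * h j, h j)) \<longlonglongrightarrow> xv a (n + 1)"
      unfolding chart_def by (auto intro!: tendsto_eq_intros h0)
  qed (use den_nonzero[of a "n + 1"] in \<open>simp add: den_def\<close>)
  moreover have "?Q \<longlonglongrightarrow> proj_hat (xv a (n + 2))"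
  proof (rule tendsto_proj_hat)
    show "(\<lambda>j. chart a n (1 - h j, h j)) \<longlonglongrightarrow> xv a (n + 2)"
      unfolding chart_def by (auto intro!: tendsto_eq_intros h0)
  qed (use den_nonzero[of a "n + 2"] in \<open>simp add: den_def\<close>)
  ultimately have "(\<lambda>j. dist (?P j) (?Q j)) \<longlonglongrightarrow>
      dist (proj_hat (xv a (n + 1))) (proj_hat (xv a (n + 2)))"
    by (rule tendsto_dist)
  moreover have "dist (?P j) (?Q j) \<le> diameter (Tri_seq a n)" for j
    using h[of j]
    by (intro diameter_bounded_bound bounded_Tri_seq proj_hat_chart_in_Tri_seq) auto
  ultimately show ?thesis using LIMSEQ_le_const2 by blast
qed

section \<open>Late tails of the product and the equivalence\<close>

lemma tail_prod_ge:
  fixes f :: "nat \<Rightarrow> real"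
  assumes f: "\<And>n. 0 < f n" "\<And>n. f n \<le> 1"
    and lim: "\<not> (\<lambda>n. \<Prod>i\<le>n. f i) \<longlonglongrightarrow> 0"
  obtains N where "\<And>k. 3 / 4 \<le> (\<Prod>i<k. f (N + i))"
proof -
  define p where "p n = (\<Prod>i\<le>n. f i)" for n
  have p: "0 < p n" for n by (simp add: p_def f prod_pos)
  have dec: "decseq p"
    unfolding decseq_Suc_iff using mult_left_le[OF f(2) less_imp_le[OF p]]
    by (simp add: p_def)
  obtain L where L: "p \<longlonglongrightarrow> L" "\<And>n. L \<le> p n"
    using decseq_convergent[OF dec, of 0] p less_imp_le by metis
  have "0 \<le> L" by (rule LIMSEQ_le_const[OF L(1)]) (use p less_imp_le in blast)
  moreover have "L \<noteq> 0" using lim L(1) unfolding p_def by blast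
  ultimately have L0: "0 < L" by simp
  then have "eventually (\<lambda>n. p n < 4 / 3 * L) sequentially"
    by (intro order_tendstoD[OF L(1)]) simp
  then obtain N where N: "p N < 4 / 3 * L" unfolding eventually_sequentially by blast
  \<comment> \<open>A tail starting at \<open>Suc N\<close> is the quotient of
    \<open>p (N + k)\<close>, at least \<open>L\<close>, by \<open>p N\<close>, less than
    \<open>4 / 3 * L\<close>.\<close>
  have split: "p (N + k) = p N * (\<Prod>i<k. f (Suc N + i))" for k
    by (induction k) (simp_all add: p_def)
  have "3 / 4 \<le> (\<Prod>i<k. f (Suc N + i))" for k
  proof (rule ccontr)
    assume "\<not> ?thesis"
    then have "p N * (\<Prod>i<k. f (Suc N + i)) < p N * (3 / 4)"
      using p[of N] by simp
    then have "L < p N * (3 / 4)" using L(2)[of "N + k"] split[of k] by simp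
    then show False using N by simp
  qed
  then show ?thesis using that by blast
qed

theorem theorem9:
  fixes a :: "nat \<Rightarrow> nat"
  assumes "\<And>n. a n \<noteq> 0"
  shows "determines_unique_point a \<longleftrightarrow>
    (\<lambda>N. \<Prod>n\<le>N. 1 - lam a n) \<longlonglongrightarrow> 0"
proof -
  note avg = ratio_dominated_averaging[OF assms]
  show ?thesis unfolding lam_eq
  proof
    assume unique: "determines_unique_point a"
    show "(\<lambda>N. \<Prod>n\<le>N. weight a n) \<longlonglongrightarrow> 0"
    proof (rule ccontr)
      assume nz: "\<not> ?thesis"
      \<comment> \<open>The weights are the same for every test vector, so 0 suffices to read off
        their bounds.\<close>
      interpret ax: dominated_averaging "\<lambda>n. den a (n + 2) / den a (n + 3)" "weight a"
        "\<lambda>n. den a n / den a (n + 3)" "ratio a 0"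
        by (rule avg)
      have "weight a n \<le> 1" for n using ax.nonneg[of n] ax.sum1[of n] by linarith
      then obtain N where N: "\<And>k. 3 / 4 \<le> (\<Prod>i<k. weight a (N + i))"
        using tail_prod_ge[OF ax.pos _ nz] by blast
      \<comment> \<open>Orthogonal to \<open>xv a N\<close> and \<open>xv a (N + 2)\<close>; against
        \<open>xv a (N + 1)\<close> the cross product gives the determinant 1, and the scaling turns
        this into the ratio 1.\<close>
      define w where "w = den a (N + 1) *\<^sub>R cross3 (xv a (N + 2)) (xv a N)"
      interpret dominated_averaging "\<lambda>n. den a (n + 2) / den a (n + 3)" "weight a"
        "\<lambda>n. den a n / den a (n + 3)" "ratio a w"
        by (rule avg)
      have triple: "cross3 v u \<bullet> z = u \<bullet> cross3 z v" for u v z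
        by (simp add: cross3_def inner_vec_def sum_3 algebra_simps)
      have "ratio a w N = 0" "ratio a w (N + 1) = 1" "ratio a w (N + 2) = 0"
        using xv_det[of a N]
        by (simp_all add: ratio_def w_def triple dot_cross_self cross_refl)
      then have sep: "1 / 2 \<le> ratio a w (N + 2 * j + 1) - ratio a w (N + 2 * j + 2)" for j
        using separation N by blast
      \<comment> \<open>A Lipschitz constant of the affine function \<open>w\<close>, with respect
        to the larger coordinate difference.\<close>
      define K where "K = \<bar>w $ 2\<bar> + \<bar>w $ 3\<bar>"
      have lip: "ratio a w (n + 1) - ratio a w (n + 2) \<le> K * diameter (Tri_seq a n)" for n
      proof -
        let ?P = "proj_hat (xv a (n + 1))" and ?Q = "proj_hat (xv a (n + 2))"
        have d: "\<bar>fst ?P - fst ?Q\<bar> \<le> diameter (Tri_seq a n)" "\<bar>snd ?P - snd ?Q\<bar> \<le> diameter (Tri_seq a n)"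
          using dist_proj_hat_le_diameter[of a n] dist_fst_le[of ?P ?Q] dist_snd_le[of ?P ?Q]
          by (simp_all add: dist_real_def)
        have "ratio a w (n + 1) - ratio a w (n + 2) = w $ 2 * (fst ?P - fst ?Q) + w $ 3 * (snd ?P - snd ?Q)"
          by (simp add: ratio_eq algebra_simps)
        also have "\<dots> \<le> \<bar>w $ 2\<bar> * \<bar>fst ?P - fst ?Q\<bar> + \<bar>w $ 3\<bar> * \<bar>snd ?P - snd ?Q\<bar>"
          by (intro add_mono) (metis abs_ge_self abs_mult)+
        also have "\<dots> \<le> \<bar>w $ 2\<bar> * diameter (Tri_seq a n) + \<bar>w $ 3\<bar> * diameter (Tri_seq a n)"
          using d by (intro add_mono mult_left_mono) auto
        finally show ?thesis by (simp add: K_def distrib_right)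
      qed
      have "(\<lambda>n. K * diameter (Tri_seq a n)) \<longlonglongrightarrow> 0"
        using unique tendsto_mult_right_zero unfolding determines_unique_point_def by blast
      then have "eventually (\<lambda>n. K * diameter (Tri_seq a n) < 1 / 2) sequentially"
        by (rule order_tendstoD) simp
      then obtain k where k: "\<And>n. k \<le> n \<Longrightarrow> K * diameter (Tri_seq a n) < 1 / 2"
        unfolding eventually_sequentially by blast
      show False using k[of "N + 2 * k"] sep[of k] lip[of "N + 2 * k"] by simp
    qed
  next
    assume prod0: "(\<lambda>N. \<Prod>n\<le>N. weight a n) \<longlonglongrightarrow> 0"
    define osc where "osc w n = averaging.hi (ratio a w) n - averaging.lo (ratio a w) n" for w n
    have osc: "osc w \<longlonglongrightarrow> 0" for w
      unfolding osc_def using dominated_averaging.window_shrinks[OF avg prod0] .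
    \<comment> \<open>The vectors \<open>axis 2 1\<close> and \<open>axis 3 1\<close> read off the
      two plane coordinates, whose oscillations together bound the distance.\<close>
    have le: "diameter (Tri_seq a n) \<le> osc (axis 2 1) n + osc (axis 3 1) n" for n
    proof -
      have diff: "\<bar>w \<bullet> vector [1, fst p, snd p] - w \<bullet> vector [1, fst q, snd q]\<bar> \<le> osc w n"
        if "p \<in> Tri_seq a n" "q \<in> Tri_seq a n" for p q w
        unfolding osc_def by (rule inner_Tri_seq_diff_le[OF avg that])
      have "dist p q \<le> osc (axis 2 1) n + osc (axis 3 1) n"
        if "p \<in> Tri_seq a n" "q \<in> Tri_seq a n" for p q
      proof -
        have "dist p q \<le> \<bar>fst p - fst q\<bar> + \<bar>snd p - snd q\<bar>"
          unfolding dist_prod_def dist_real_def by (metis real_sqrt_abs sqrt_sum_squares_le_sum_abs power2_abs)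
        also have "\<dots> \<le> osc (axis 2 1) n + osc (axis 3 1) n"
          using diff[OF that, of "axis 2 1"] diff[OF that, of "axis 3 1"] by (simp add: inner_axis')
        finally show ?thesis .
      qed
      moreover have "Tri_seq a n \<noteq> {}"
        using proj_hat_chart_in_Tri_seq[of "1 / 3" "1 / 2" a n] by auto
      ultimately show ?thesis by (intro diameter_le) (auto simp: dist_norm)
    qed
    have "(\<lambda>n. osc (axis 2 1) n + osc (axis 3 1) n) \<longlonglongrightarrow> 0"
      using tendsto_add[OF osc osc] by simp
    then show "determines_unique_point a"
      unfolding determines_unique_point_def
      by (rule tendsto_sandwich[OF _ _ tendsto_const, rotated 2])
        (auto simp: le diameter_ge_0 bounded_Tri_seq)
  qed
qed

end
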